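(* Let $\langle A,\rightarrow,\top\rangle$ be a BCI-algebra such that $\langle A,\preceq\rangle$ is a meet-semilattice and $x\rightarrow(y\wedge z)=(x\rightarrow y)\wedge(x\rightarrow z)$ for all $x,y,z\in A$. Let $\mathbb{A}=\{[\underline X,\overline X]:\underline X,\overline X\in A,\ \underline X\preceq\overline X\}$ and for $X,Y\in\mathbb{A}$ define $X\Rightarrow\!\!> Y=[\overline{X}\rightarrow\underline{Y},\ \underline{X}\rightarrow\overline{Y}]$ and $X\Rightarrow Y=[(\underline{X}\rightarrow\underline{Y})\wedge(\overline{X}\rightarrow\overline{Y}),\ \underline{X}\rightarrow\overline{Y}]$. Define $X\ll Y$ iff $X\Rightarrow\!\!> Y=[\top,\top]$ and $X\precsim Y$ iff $X\Rightarrow Y=[\top,\top]$. Then $\Rightarrow\!\!>$ is the best interval representation of $\rightarrow$, and for all $X,Y,Z\in\mathbb{A}$: (1) $X\Rightarrow\!\!>(Y\Rightarrow\!\!> Z)=Y\Rightarrow\!\!>(X\Rightarrow\!\!> Z)$; (2) $X\Rightarrow(Y\Rightarrow Z)=Y\Rightarrow(X\Rightarrow Z)$; (3) $X\Rightarrow\!\!> Y\precsim(Z\Rightarrow\!\!> X)\Rightarrow(Z\Rightarrow\!\!> Y)$; (4) $[\top,\top]\Rightarrow\!\!> X=X$; (5) if $X\ll Y\precsim Z$ then $X\ll Z$; (6) if $X\precsim Y\ll Z$ then $X\ll Z$; (7) if $X\precsim Y$ and $Y\precsim X$ then $X=Y$. Moreover, if $A$ has at least one element different from $\top$, then $\langle\mathbb{A},\Rightarrow\!\!>,[\top,\top]\rangle$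 is not a BCI-algebra.
   Context: A BCI-algebra is a structure $\langle B,\rightarrow,\top\rangle$, with $\rightarrow$ a binary operation on $B$ and $\top\in B$, such that for all $x,y,z\in B$: (C1) $(y\rightarrow z)\rightarrow((z\rightarrow x)\rightarrow(y\rightarrow x))=\top$; (C2) $x\rightarrow((x\rightarrow y)\rightarrow y)=\top$; (C3) $x\rightarrow x=\top$; (C4) if $x\rightarrow y=\top$ and $y\rightarrow x=\top$ then $x=y$. Its induced relation is $x\preceq y$ iff $x\rightarrow y=\top$ (a partial order); $\wedge$ denotes meet w.r.t. $\preceq$. For $X=[a,b]\in\mathbb{A}$, $\underline X=a$, $\overline X=b$, and $x\in X$ means $\underline X\preceq x\preceq\overline X$. An operation $F:\mathbb{A}\times\mathbb{A}\to\mathbb{A}$ is an interval representation of $\rightarrow$ if $x\rightarrow y\in F(X,Y)$ whenever $x\in X$, $y\in Y$; it is the best interval representation if it is an interval representation and $F(X,Y)\subseteq G(X,Y)$ (as sets of elements of $A$) for every interval representation $G$ of $\rightarrow$ and all $X,Y\in\mathbb{A}$. *)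

theory Defs
  imports "HOL-Algebra.Lattice"
begin

record 'a bci = "'a partial_object" +
  arrow :: "'a \<Rightarrow> 'a \<Rightarrow> 'a" (infixr \<open>\<leadsto>\<index>\<close> 75)
  top_elem :: 'a (\<open>\<^bold>\<top>\<index>\<close>)

locale bci_algebra =
  fixes B (structure)
  assumes arrow_closed: "\<lbrakk>x \<in> carrier B; y \<in> carrier B\<rbrakk> \<Longrightarrow> x \<leadsto> y \<in> carrier B"
    and top_closed: "\<^bold>\<top> \<in> carrier B"
    and C1: "\<lbrakk>x \<in> carrier B; y \<in> carrier B; z \<in> carrier B\<rbrakk>
      \<Longrightarrow> (y \<leadsto> z) \<leadsto> ((z \<leadsto> x) \<leadsto> (y \<leadsto> x)) = \<^bold>\<top>"
    and C2: "\<lbrakk>x \<in> carrier B; y \<in> carrier B\<rbrakk> \<Longrightarrow> x \<leadsto> ((x \<leadsto> y) \<leadsto> y) = \<^bold>\<top>"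
    and C3: "x \<in> carrier B \<Longrightarrow> x \<leadsto> x = \<^bold>\<top>"
    and C4: "\<lbrakk>x \<in> carrier B; y \<in> carrier B; x \<leadsto> y = \<^bold>\<top>; y \<leadsto> x = \<^bold>\<top>\<rbrakk> \<Longrightarrow> x = y"

definition bci_order :: "('a, 'b) bci_scheme \<Rightarrow> 'a gorder" where
  "bci_order A = \<lparr>carrier = carrier A, eq = (=), le = (\<lambda>x y. x \<leadsto>\<^bsub>A\<^esub> y = \<^bold>\<top>\<^bsub>A\<^esub>)\<rparr>"

text \<open>An interval is represented by the pair of its endpoints; since the endpoints are ordered
  and the order is antisymmetric, this pair is determined by the set of elements of the interval.\<close>

definition intervals :: "('a, 'b) bci_scheme \<Rightarrow> ('a \<times> 'a) set" where
  "intervals A = {(a, b). a \<in> carrier A \<and> b \<in> carrier A \<and> a \<sqsubseteq>\<^bsub>bci_order A\<^esub> b}"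

definition elements :: "('a, 'b) bci_scheme \<Rightarrow> 'a \<times> 'a \<Rightarrow> 'a set" where
  "elements A X = \<lbrace>fst X..snd X\<rbrace>\<^bsub>bci_order A\<^esub>"

definition interval_representation ::
    "('a, 'b) bci_scheme \<Rightarrow> ('a \<times> 'a \<Rightarrow> 'a \<times> 'a \<Rightarrow> 'a \<times> 'a) \<Rightarrow> bool" where
  "interval_representation A F \<longleftrightarrow>
    (\<forall>X\<in>intervals A. \<forall>Y\<in>intervals A. F X Y \<in> intervals A) \<and>
    (\<forall>X\<in>intervals A. \<forall>Y\<in>intervals A. \<forall>x\<in>elements A X. \<forall>y\<in>elements A Y.
      x \<leadsto>\<^bsub>A\<^esub> y \<in> elements A (F X Y))"

definition best_interval_representation ::
    "('a, 'b) bci_scheme \<Rightarrow> ('a \<times> 'a \<Rightarrow> 'a \<times> 'a \<Rightarrow> 'a \<times> 'a) \<Rightarrow> bool" where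
  "best_interval_representation A F \<longleftrightarrow>
    interval_representation A F \<and>
    (\<forall>G. interval_representation A G \<longrightarrow>
      (\<forall>X\<in>intervals A. \<forall>Y\<in>intervals A. elements A (F X Y) \<subseteq> elements A (G X Y)))"

definition arrow_best :: "('a, 'b) bci_scheme \<Rightarrow> 'a \<times> 'a \<Rightarrow> 'a \<times> 'a \<Rightarrow> 'a \<times> 'a"
    (infixr \<open>\<leadsto>>\<index>\<close> 75) where
  "X \<leadsto>>\<^bsub>A\<^esub> Y = (snd X \<leadsto>\<^bsub>A\<^esub> fst Y, fst X \<leadsto>\<^bsub>A\<^esub> snd Y)"

definition arrow_meet :: "('a, 'b) bci_scheme \<Rightarrow> 'a \<times> 'a \<Rightarrow> 'a \<times> 'a \<Rightarrow> 'a \<times> 'a"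
    (infixr \<open>\<Rrightarrow>\<index>\<close> 75) where
  "X \<Rrightarrow>\<^bsub>A\<^esub> Y =
    ((fst X \<leadsto>\<^bsub>A\<^esub> fst Y) \<sqinter>\<^bsub>bci_order A\<^esub> (snd X \<leadsto>\<^bsub>A\<^esub> snd Y), fst X \<leadsto>\<^bsub>A\<^esub> snd Y)"

definition strong_le :: "('a, 'b) bci_scheme \<Rightarrow> 'a \<times> 'a \<Rightarrow> 'a \<times> 'a \<Rightarrow> bool"
    (infix \<open>\<lless>\<index>\<close> 50) where
  "X \<lless>\<^bsub>A\<^esub> Y \<longleftrightarrow> X \<leadsto>>\<^bsub>A\<^esub> Y = (\<^bold>\<top>\<^bsub>A\<^esub>, \<^bold>\<top>\<^bsub>A\<^esub>)"

definition weak_le :: "('a, 'b) bci_scheme \<Rightarrow> 'a \<times> 'a \<Rightarrow> 'a \<times> 'a \<Rightarrow> bool"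
    (infix \<open>\<lesssim>\<index>\<close> 50) where
  "X \<lesssim>\<^bsub>A\<^esub> Y \<longleftrightarrow> X \<Rrightarrow>\<^bsub>A\<^esub> Y = (\<^bold>\<top>\<^bsub>A\<^esub>, \<^bold>\<top>\<^bsub>A\<^esub>)"

definition interval_bci :: "('a, 'b) bci_scheme \<Rightarrow> ('a \<times> 'a) bci" where
  "interval_bci A =
    \<lparr>carrier = intervals A, arrow = (\<leadsto>>\<^bsub>A\<^esub>), top_elem = (\<^bold>\<top>\<^bsub>A\<^esub>, \<^bold>\<top>\<^bsub>A\<^esub>)\<rparr>"

text \<open>Both interval operations are well defined, i.e. their values are intervals.\<close>

context bci_algebra
begin

lemma top_arrow_eq_top:
  assumes "x \<in> carrier B" "\<^bold>\<top> \<leadsto> x = \<^bold>\<top>"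
  shows "x = \<^bold>\<top>"
proof -
  have "x \<leadsto> ((x \<leadsto> x) \<leadsto> x) = \<^bold>\<top>" using C2[of x x] assms by simp
  then have "x \<leadsto> \<^bold>\<top> = \<^bold>\<top>" using C3[of x] assms by simp
  then show ?thesis using C4[of x "\<^bold>\<top>"] assms top_closed by simp
qed

lemma le_trans:
  assumes "x \<in> carrier B" "y \<in> carrier B" "z \<in> carrier B" "x \<leadsto> y = \<^bold>\<top>" "y \<leadsto> z = \<^bold>\<top>"
  shows "x \<leadsto> z = \<^bold>\<top>"
proof -
  have "\<^bold>\<top> \<leadsto> (\<^bold>\<top> \<leadsto> (x \<leadsto> z)) = \<^bold>\<top>" using C1[of z x y] assms by simp
  then show ?thesis using assms by (metis arrow_closed top_arrow_eq_top top_closed)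
qed

lemma arrow_antimono:
  assumes "x \<in> carrier B" "y \<in> carrier B" "z \<in> carrier B" "y \<leadsto> z = \<^bold>\<top>"
  shows "(z \<leadsto> x) \<leadsto> (y \<leadsto> x) = \<^bold>\<top>"
  using C1[of x y z] assms by (metis arrow_closed top_arrow_eq_top)

lemma arrow_mono:
  assumes "x \<in> carrier B" "y \<in> carrier B" "z \<in> carrier B" "y \<leadsto> z = \<^bold>\<top>"
  shows "(x \<leadsto> y) \<leadsto> (x \<leadsto> z) = \<^bold>\<top>"
proof -
  let ?p = "x \<leadsto> y" and ?q = "x \<leadsto> z"
  have c: "?p \<in> carrier B" "?q \<in> carrier B" "?p \<leadsto> z \<in> carrier B" "y \<leadsto> z \<in> carrier B"
    "(y \<leadsto> z) \<leadsto> ?q \<in> carrier B"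
    using assms by (simp_all add: arrow_closed top_closed)
  have 1: "?p \<leadsto> ((y \<leadsto> z) \<leadsto> ?q) = \<^bold>\<top>" using C1[of z x y] assms by simp
  have "\<^bold>\<top> \<leadsto> ((\<^bold>\<top> \<leadsto> ?q) \<leadsto> ?q) = \<^bold>\<top>" using C2[of "\<^bold>\<top>" ?q] c top_closed by simp
  then have 2: "(\<^bold>\<top> \<leadsto> ?q) \<leadsto> ?q = \<^bold>\<top>" using c by (metis arrow_closed top_arrow_eq_top top_closed)
  show ?thesis
    by (rule le_trans[OF c(1) _ c(2) 1[unfolded assms(4)] 2]) (intro arrow_closed top_closed c)
qed

lemma arrow_interval_mono:
  assumes "X \<in> intervals B" "Y \<in> intervals B"
  shows "(snd X \<leadsto> fst Y) \<leadsto> (fst X \<leadsto> fst Y) = \<^bold>\<top>"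
    and "(fst X \<leadsto> fst Y) \<leadsto> (fst X \<leadsto> snd Y) = \<^bold>\<top>"
  using assms by (auto simp: intervals_def bci_order_def intro: arrow_antimono arrow_mono)

lemma arrow_best_closed:
  assumes "X \<in> intervals B" "Y \<in> intervals B"
  shows "X \<leadsto>> Y \<in> intervals B"
proof -
  have c: "fst X \<in> carrier B" "snd X \<in> carrier B" "fst Y \<in> carrier B" "snd Y \<in> carrier B"
    using assms by (auto simp: intervals_def)
  show ?thesis
    using le_trans[OF _ _ _ arrow_interval_mono[OF assms]] c
    by (simp add: arrow_best_def intervals_def bci_order_def arrow_closed)
qed

lemma arrow_meet_closed:
  assumes "lower_semilattice (bci_order B)" "X \<in> intervals B" "Y \<in> intervals B"
  shows "X \<Rrightarrow> Y \<in> intervals B"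
proof -
  interpret L: lower_semilattice "bci_order B" by fact
  have c: "fst X \<leadsto> fst Y \<in> carrier B" "snd X \<leadsto> snd Y \<in> carrier B" "fst X \<leadsto> snd Y \<in> carrier B"
    using assms(2,3) by (auto simp: intervals_def arrow_closed)
  have carr: "carrier (bci_order B) = carrier B" by (simp add: bci_order_def)
  have le: "fst X \<leadsto> fst Y \<sqsubseteq>\<^bsub>bci_order B\<^esub> fst X \<leadsto> snd Y"
    using arrow_interval_mono(2)[OF assms(2,3)] by (simp add: bci_order_def)
  show ?thesis
    using L.meet_closed L.le_trans[OF L.meet_left le] c
    by (simp add: arrow_meet_def intervals_def carr)
qed

end

end

theory Submission
  imports Defs
begin

text \<open>The arrow is antitone on the left and monotone on the right, so on X x Y it takes its
  least value at (\<open>snd X\<close>, \<open>fst Y\<close>) and its greatest at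
  (\<open>fst X\<close>, \<open>snd Y\<close>). These extremes are attained; hence every interval
  representation contains both, and with them everything in between
  (\<open>best_interval_representation_arrow_best\<close>).

  The identities come endpointwise from \<open>top_arrow\<close> and \<open>arrow_exchange\<close>.
  Since the top is maximal, a meet is the top only if both its arguments are; so
  \<open>weak_le\<close> is the endpointwise order (\<open>weak_le_iff\<close>), and (3) and (5)-(7)
  reduce to inequalities between endpoints. Distributivity enters in (2), to pull an arrow through
  the meet in a lower endpoint.

  The interval structure violates reflexivity: \<open>C3\<close> at a pair (m, top) demands that top
  arrow m, which is m, be the top. An m strictly below the top is the meet of the top with any other
  element.\<close>

context bci_algebra
begin

text \<open>\<open>C2\<close> puts the top below (top arrow x) arrow x, and maximality of the top
  turns this into one inequality; \<open>C2\<close> at x, x gives the other.\<close>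

lemma top_arrow:
  assumes "x \<in> carrier B"
  shows "\<^bold>\<top> \<leadsto> x = x"
proof (rule C4)
  have "\<^bold>\<top> \<leadsto> ((\<^bold>\<top> \<leadsto> x) \<leadsto> x) = \<^bold>\<top>"
    using C2 assms top_closed by simp
  then show "(\<^bold>\<top> \<leadsto> x) \<leadsto> x = \<^bold>\<top>"
    using assms arrow_closed top_closed top_arrow_eq_top by metis
  show "x \<leadsto> \<^bold>\<top> \<leadsto> x = \<^bold>\<top>"
    using C2[of x x] C3[of x] assms by simp
qed (use assms arrow_closed top_closed in auto)

text \<open>\<open>C1\<close> composes x \<leadsto> (y \<leadsto> z) with an arrow into z, which
  leaves (y \<leadsto> z) \<leadsto> z in front; \<open>C2\<close> places y below this element, so
  antitonicity replaces it by y.\<close>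

lemma arrow_exchange_le:
  assumes "x \<in> carrier B" "y \<in> carrier B" "z \<in> carrier B"
  shows "(x \<leadsto> y \<leadsto> z) \<leadsto> (y \<leadsto> x \<leadsto> z) = \<^bold>\<top>"
proof (rule le_trans)
  show "(x \<leadsto> y \<leadsto> z) \<leadsto> (((y \<leadsto> z) \<leadsto> z) \<leadsto> x \<leadsto> z) = \<^bold>\<top>"
    using C1[of z x "y \<leadsto> z"] assms by (simp add: arrow_closed)
  show "(((y \<leadsto> z) \<leadsto> z) \<leadsto> x \<leadsto> z) \<leadsto> (y \<leadsto> x \<leadsto> z) = \<^bold>\<top>"
    using arrow_antimono[of "x \<leadsto> z" y "(y \<leadsto> z) \<leadsto> z"] C2[of y z] assms
    by (simp add: arrow_closed)
qed (use assms arrow_closed in auto)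

lemma arrow_exchange:
  assumes "x \<in> carrier B" "y \<in> carrier B" "z \<in> carrier B"
  shows "x \<leadsto> y \<leadsto> z = y \<leadsto> x \<leadsto> z"
  by (rule C4[OF _ _ arrow_exchange_le arrow_exchange_le]) (simp_all add: assms arrow_closed)

text \<open>This is \<open>C1\<close> with its two antecedents exchanged: composition as left
  multiplication.\<close>

lemma arrow_comp_le:
  assumes "x \<in> carrier B" "y \<in> carrier B" "z \<in> carrier B"
  shows "(x \<leadsto> y) \<leadsto> ((z \<leadsto> x) \<leadsto> (z \<leadsto> y)) = \<^bold>\<top>"
  using C1[of y z x] arrow_exchange[of "x \<leadsto> y" "z \<leadsto> x" "z \<leadsto> y"] assms
  by (simp add: arrow_closed)

lemma intervals_iff:
  "X \<in> intervals B \<longleftrightarrow>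
    fst X \<in> carrier B \<and> snd X \<in> carrier B \<and> fst X \<leadsto> snd X = \<^bold>\<top>"
  by (auto simp: intervals_def bci_order_def)

lemma elements_iff:
  "x \<in> elements B X \<longleftrightarrow> x \<in> carrier B \<and> fst X \<leadsto> x = \<^bold>\<top> \<and> x \<leadsto> snd X = \<^bold>\<top>"
  by (auto simp: elements_def bci_order_def at_least_at_most_def)

text \<open>Each bound moves one argument at a time to an endpoint, through x \<leadsto>
  \<open>fst Y\<close> below and \<open>fst X\<close> \<leadsto> y above.\<close>

lemma arrow_mem_arrow_best:
  assumes "X \<in> intervals B" "Y \<in> intervals B" "x \<in> elements B X" "y \<in> elements B Y"
  shows "x \<leadsto> y \<in> elements B (X \<leadsto>> Y)"
proof -
  have c: "x \<in> carrier B" "y \<in> carrier B" "fst X \<in> carrier B" "snd X \<in> carrier B"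
      "fst Y \<in> carrier B" "snd Y \<in> carrier B"
    using assms by (simp_all add: intervals_iff elements_iff)
  have o: "fst X \<leadsto> x = \<^bold>\<top>" "x \<leadsto> snd X = \<^bold>\<top>" "fst Y \<leadsto> y = \<^bold>\<top>" "y \<leadsto> snd Y = \<^bold>\<top>"
    using assms by (simp_all add: elements_iff)
  have "(snd X \<leadsto> fst Y) \<leadsto> (x \<leadsto> y) = \<^bold>\<top>"
    using le_trans[OF _ _ _ arrow_antimono[of "fst Y" x "snd X"] arrow_mono[of x "fst Y" y]] c o
    by (simp add: arrow_closed)
  moreover have "(x \<leadsto> y) \<leadsto> (fst X \<leadsto> snd Y) = \<^bold>\<top>"
    using le_trans[OF _ _ _ arrow_antimono[of y "fst X" x] arrow_mono[of "fst X" y "snd Y"]] c o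
    by (simp add: arrow_closed)
  ultimately show ?thesis
    using c by (simp add: elements_iff arrow_best_def arrow_closed)
qed

lemma best_interval_representation_arrow_best:
  "best_interval_representation B (\<leadsto>>\<^bsub>B\<^esub>)"
  unfolding best_interval_representation_def
proof (intro conjI allI impI ballI)
  show "interval_representation B (\<leadsto>>\<^bsub>B\<^esub>)"
    by (simp add: interval_representation_def arrow_best_closed arrow_mem_arrow_best)
next
  fix G X Y
  assume G: "interval_representation B G" and X: "X \<in> intervals B" and Y: "Y \<in> intervals B"
  have ends: "fst X \<in> elements B X" "snd X \<in> elements B X"
      "fst Y \<in> elements B Y" "snd Y \<in> elements B Y"
    using X Y C3 by (simp_all add: intervals_iff elements_iff)
  have mem: "snd X \<leadsto> fst Y \<in> elements B (G X Y)" "fst X \<leadsto> snd Y \<in> elements B (G X Y)"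
    and int: "G X Y \<in> intervals B"
    using G X Y ends by (simp_all add: interval_representation_def)
  show "elements B (X \<leadsto>> Y) \<subseteq> elements B (G X Y)"
  proof
    fix z assume "z \<in> elements B (X \<leadsto>> Y)"
    then show "z \<in> elements B (G X Y)"
      using mem int le_trans[of "fst (G X Y)" "snd X \<leadsto> fst Y" z]
        le_trans[of z "fst X \<leadsto> snd Y" "snd (G X Y)"]
      by (simp add: elements_iff intervals_iff arrow_best_def)
  qed
qed

lemma arrow_best_exchange:
  assumes "X \<in> intervals B" "Y \<in> intervals B" "Z \<in> intervals B"
  shows "X \<leadsto>> (Y \<leadsto>> Z) = Y \<leadsto>> (X \<leadsto>> Z)"
  using assms arrow_exchange by (simp add: arrow_best_def intervals_iff)

lemma top_arrow_best: "X \<in> intervals B \<Longrightarrow> (\<^bold>\<top>, \<^bold>\<top>) \<leadsto>> X = X"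
  by (simp add: arrow_best_def intervals_iff top_arrow)

lemma strong_le_iff: "X \<lless> Y \<longleftrightarrow> snd X \<leadsto> fst Y = \<^bold>\<top> \<and> fst X \<leadsto> snd Y = \<^bold>\<top>"
  by (simp add: strong_le_def arrow_best_def)

end

locale bci_semilattice = bci_algebra +
  assumes semilattice: "lower_semilattice (bci_order B)"
begin

sublocale L: lower_semilattice "bci_order B"
  rewrites "carrier (bci_order B) = carrier B"
    and "x \<sqsubseteq>\<^bsub>bci_order B\<^esub> y \<longleftrightarrow> x \<leadsto> y = \<^bold>\<top>"
    and "x .=\<^bsub>bci_order B\<^esub> y \<longleftrightarrow> x = y"
  by (fact semilattice) (simp_all add: bci_order_def)

text \<open>Each argument lies above the meet, and nothing lies strictly above the top.\<close>

lemma meet_eq_top_iff: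
  assumes "x \<in> carrier B" "y \<in> carrier B"
  shows "x \<sqinter>\<^bsub>bci_order B\<^esub> y = \<^bold>\<top> \<longleftrightarrow> x = \<^bold>\<top> \<and> y = \<^bold>\<top>"
proof
  assume "x \<sqinter>\<^bsub>bci_order B\<^esub> y = \<^bold>\<top>"
  then show "x = \<^bold>\<top> \<and> y = \<^bold>\<top>"
    using L.meet_left[OF assms] L.meet_right[OF assms] assms top_arrow_eq_top by simp
next
  assume "x = \<^bold>\<top> \<and> y = \<^bold>\<top>"
  then show "x \<sqinter>\<^bsub>bci_order B\<^esub> y = \<^bold>\<top>"
    using L.meet_le[of "\<^bold>\<top>" "\<^bold>\<top>" "\<^bold>\<top>"] C3 top_closed top_arrow_eq_top L.meet_closed by simp
qed

text \<open>The upper endpoint of X \<Rrightarrow> Y adds no condition: \<open>fst X\<close> \<le>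
  \<open>fst Y\<close> \<le> \<open>snd Y\<close>.\<close>

lemma weak_le_iff:
  assumes "X \<in> intervals B" "Y \<in> intervals B"
  shows "X \<lesssim> Y \<longleftrightarrow> fst X \<leadsto> fst Y = \<^bold>\<top> \<and> snd X \<leadsto> snd Y = \<^bold>\<top>"
  using assms le_trans[of "fst X" "fst Y" "snd Y"]
  by (auto simp: weak_le_def arrow_meet_def meet_eq_top_iff arrow_closed intervals_iff)

lemma arrow_meet_exchange:
  assumes distrib: "\<And>x y z. \<lbrakk>x \<in> carrier B; y \<in> carrier B; z \<in> carrier B\<rbrakk> \<Longrightarrow>
      x \<leadsto> (y \<sqinter>\<^bsub>bci_order B\<^esub> z) = (x \<leadsto> y) \<sqinter>\<^bsub>bci_order B\<^esub> (x \<leadsto> z)"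
    and X: "X \<in> intervals B" and Y: "Y \<in> intervals B" and Z: "Z \<in> intervals B"
  shows "X \<Rrightarrow> (Y \<Rrightarrow> Z) = Y \<Rrightarrow> (X \<Rrightarrow> Z)"
proof -
  \<comment> \<open>Distributivity expands the lower endpoint into a triple meet. Under exchange,
    swapping U and V fixes the first term and interchanges the other two.\<close>
  have *: "fst (U \<Rrightarrow> (V \<Rrightarrow> Z)) = (fst U \<leadsto> fst V \<leadsto> fst Z) \<sqinter>\<^bsub>bci_order B\<^esub>
      ((fst U \<leadsto> snd V \<leadsto> snd Z) \<sqinter>\<^bsub>bci_order B\<^esub> (snd U \<leadsto> fst V \<leadsto> snd Z))"
    if "U \<in> intervals B" "V \<in> intervals B" for U V
    using that Z L.weak_meet_assoc
    by (simp add: arrow_meet_def intervals_iff distrib arrow_closed)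
  have "fst (X \<Rrightarrow> (Y \<Rrightarrow> Z)) = fst (Y \<Rrightarrow> (X \<Rrightarrow> Z))"
    unfolding *[OF X Y] *[OF Y X]
    using X Y Z arrow_exchange meet_comm[of "bci_order B"] by (simp add: intervals_iff)
  then show ?thesis
    using X Y Z arrow_exchange by (simp add: prod_eq_iff) (simp add: arrow_meet_def intervals_iff)
qed

lemma arrow_best_weak_le_comp:
  assumes "X \<in> intervals B" "Y \<in> intervals B" "Z \<in> intervals B"
  shows "X \<leadsto>> Y \<lesssim> (Z \<leadsto>> X) \<Rrightarrow> (Z \<leadsto>> Y)"
proof -
  obtain a b c d e f where [simp]: "X = (a, b)" "Y = (c, d)" "Z = (e, f)"
    by (metis surj_pair)
  have [simp]: "a \<in> carrier B" "b \<in> carrier B" "c \<in> carrier B" "d \<in> carrier B"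
      "e \<in> carrier B" "f \<in> carrier B"
    and o: "a \<leadsto> b = \<^bold>\<top>" "c \<leadsto> d = \<^bold>\<top>" "e \<leadsto> f = \<^bold>\<top>"
    using assms by (simp_all add: intervals_iff)
  note [simp] = arrow_closed
  \<comment> \<open>Facts 1 and 2 bound the two terms of the meet in the lower endpoint, through a
    \<leadsto> c and b \<leadsto> d respectively; fact 3 bounds the upper endpoint.\<close>
  have 1: "(b \<leadsto> c) \<leadsto> (f \<leadsto> a) \<leadsto> (f \<leadsto> c) = \<^bold>\<top>"
    by (rule le_trans[OF _ _ _ arrow_antimono[of c a b] arrow_comp_le]) (simp_all add: o)
  have 2: "(b \<leadsto> c) \<leadsto> (e \<leadsto> b) \<leadsto> (e \<leadsto> d) = \<^bold>\<top>"
    by (rule le_trans[OF _ _ _ arrow_mono[of b c d] arrow_comp_le]) (simp_all add: o)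
  have 3: "(a \<leadsto> d) \<leadsto> (f \<leadsto> a) \<leadsto> (e \<leadsto> d) = \<^bold>\<top>"
    by (rule le_trans[OF _ _ _ arrow_comp_le arrow_mono]) (simp_all add: o arrow_antimono)
  have closed: "X \<leadsto>> Y \<in> intervals B" "(Z \<leadsto>> X) \<Rrightarrow> (Z \<leadsto>> Y) \<in> intervals B"
    using assms by (simp_all only: arrow_best_closed arrow_meet_closed semilattice)
  show ?thesis
    unfolding weak_le_iff[OF closed]
    using L.meet_le[OF 1 2] 3 by (simp add: arrow_best_def arrow_meet_def)
qed

lemma strong_weak_le_trans:
  assumes "X \<in> intervals B" "Y \<in> intervals B" "Z \<in> intervals B" "X \<lless> Y" "Y \<lesssim> Z"
  shows "X \<lless> Z"
  using assms le_trans[of "snd X" "fst Y" "fst Z"] le_trans[of "fst X" "snd Y" "snd Z"]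
  by (simp add: strong_le_iff weak_le_iff intervals_iff)

lemma weak_strong_le_trans:
  assumes "X \<in> intervals B" "Y \<in> intervals B" "Z \<in> intervals B" "X \<lesssim> Y" "Y \<lless> Z"
  shows "X \<lless> Z"
  using assms le_trans[of "snd X" "snd Y" "fst Z"] le_trans[of "fst X" "fst Y" "snd Z"]
  by (simp add: strong_le_iff weak_le_iff intervals_iff)

lemma weak_le_antisym:
  assumes "X \<in> intervals B" "Y \<in> intervals B" "X \<lesssim> Y" "Y \<lesssim> X"
  shows "X = Y"
  using assms C4[of "fst X" "fst Y"] C4[of "snd X" "snd Y"]
  by (simp add: weak_le_iff intervals_iff prod_eq_iff)

text \<open>The order may be discrete on a general BCI-algebra (for instance \<open>x \<leadsto> y = y - x\<close> on an
  abelian group); the meet of \<open>x\<close> with \<open>\<^bold>\<top>\<close> supplies an element strictly below \<open>\<^bold>\<top>\<close>. Reflexivity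
  (C3) then fails at the interval that it spans with \<open>\<^bold>\<top>\<close>.\<close>

lemma not_bci_algebra_interval_bci:
  assumes x: "x \<in> carrier B" and "x \<noteq> \<^bold>\<top>"
  shows "\<not> bci_algebra (interval_bci B)"
proof
  assume "bci_algebra (interval_bci B)"
  then interpret I: bci_algebra "interval_bci B" .
  define m where "m = x \<sqinter>\<^bsub>bci_order B\<^esub> \<^bold>\<top>"
  have m: "m \<in> carrier B" "m \<leadsto> \<^bold>\<top> = \<^bold>\<top>" "m \<noteq> \<^bold>\<top>"
    using assms top_closed L.meet_closed L.meet_right by (simp_all add: m_def meet_eq_top_iff)
  then have "(m, \<^bold>\<top>) \<in> intervals B"
    using top_closed by (simp add: intervals_iff)
  then have "(m, \<^bold>\<top>) \<lless> (m, \<^bold>\<top>)"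
    using I.C3 by (simp add: interval_bci_def strong_le_def)
  then show False
    using m top_arrow by (simp add: strong_le_iff)
qed

end

theorem theorem2:
  fixes A :: "('a, 'b) bci_scheme" (structure)
  assumes "bci_algebra A"
    and "lower_semilattice (bci_order A)"
    and "\<forall>x\<in>carrier A. \<forall>y\<in>carrier A. \<forall>z\<in>carrier A.
      x \<leadsto> (y \<sqinter>\<^bsub>bci_order A\<^esub> z) = (x \<leadsto> y) \<sqinter>\<^bsub>bci_order A\<^esub> (x \<leadsto> z)"
  shows "best_interval_representation A (\<leadsto>>\<^bsub>A\<^esub>) \<and>
    (\<forall>X\<in>intervals A. \<forall>Y\<in>intervals A. \<forall>Z\<in>intervals A.
      X \<leadsto>> (Y \<leadsto>> Z) = Y \<leadsto>> (X \<leadsto>> Z) \<and>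
      X \<Rrightarrow> (Y \<Rrightarrow> Z) = Y \<Rrightarrow> (X \<Rrightarrow> Z) \<and>
      X \<leadsto>> Y \<lesssim> (Z \<leadsto>> X) \<Rrightarrow> (Z \<leadsto>> Y) \<and>
      (\<^bold>\<top>, \<^bold>\<top>) \<leadsto>> X = X \<and>
      (X \<lless> Y \<and> Y \<lesssim> Z \<longrightarrow> X \<lless> Z) \<and>
      (X \<lesssim> Y \<and> Y \<lless> Z \<longrightarrow> X \<lless> Z) \<and>
      (X \<lesssim> Y \<and> Y \<lesssim> X \<longrightarrow> X = Y)) \<and>
    ((\<exists>x\<in>carrier A. x \<noteq> \<^bold>\<top>) \<longrightarrow> \<not> bci_algebra (interval_bci A))"
proof -
  interpret bci_semilattice A
    using assms(1,2) by (simp add: bci_semilattice_def bci_semilattice_axioms_def)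
  show ?thesis
    \<comment> \<open>The two mixed transitivity laws have the same conclusion; the available
      premises decide which one applies.\<close>
    by (intro conjI ballI impI; (elim conjE bexE)?;
        (rule best_interval_representation_arrow_best arrow_best_exchange
          arrow_meet_exchange[OF assms(3)[rule_format]] arrow_best_weak_le_comp top_arrow_best
          strong_weak_le_trans weak_strong_le_trans weak_le_antisym not_bci_algebra_interval_bci;
          assumption))
qed

end
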